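(* Let $(\omega_n)_{n\ge 0}$ be a sequence of positive real numbers such that $\sum_n 1/\omega_n<\infty$ and $\lim_{n\to\infty}\omega_n^{1/n}=1$. Let $H$ be a Hilbert holomorphic function space on $\mathbb{D}$ such that $H$ contains the polynomials, the polynomials are dense in $H$, the odd polynomials are not dense in the set of odd functions in $H$ (with respect to the norm of $H$), and $\|z^n\|_H\le 1+\omega_n$ for all $n\ge 0$. Then there exists $f\in H$ lying outside the closed linear span in $H$ of its set of radial dilates $\{f_r: 0<r<1\}$.
   Context: $\mathbb{D}$ denotes the open unit disk in $\mathbb{C}$, and $\mathrm{Hol}(\mathbb{D})$ the Fréchet space of holomorphic functions on $\mathbb{D}$ with the topology of uniform convergence on compact sets. A Hilbert holomorphic function space on $\mathbb{D}$ is a (complex) Hilbert space $H$ that is a subset (linear subspace) of $\mathrm{Hol}(\mathbb{D})$ such that the inclusion map $H\hookrightarrow\mathrm{Hol}(\mathbb{D})$ is continuous. A function $f$ on $\mathbb{D}$ is odd if $f(-z)=-f(z)$ for all $z\in\mathbb{D}$. For $f\in\mathrm{Hol}(\mathbb{D})$ and $0<r<1$, the radial dilate $f_r$ is defined by $f_r(z):=f(rz)$. $z^n$ denotes the function $z\mapsto z^n$ on $\mathbb{D}$. *)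

theory Defs
  imports
    "HOL-Complex_Analysis.Complex_Analysis"
    "HOL-Computational_Algebra.Polynomial"
    "HOL-Library.Function_Algebras"
begin

section \<open>Functions on the open unit disc\<close>

text \<open>
  A function on the open unit disc is represented by its extension by zero to the whole plane,
  so that equality of representatives is equality on the disc and the pointwise operations of
  \<^theory>\<open>HOL-Library.Function_Algebras\<close> are the operations on functions on the disc.
\<close>

abbreviation disc :: "complex set" where
  "disc \<equiv> ball 0 1"

definition on_disc :: "(complex \<Rightarrow> complex) \<Rightarrow> complex \<Rightarrow> complex" where
  "on_disc g = (\<lambda>z. if z \<in> disc then g z else 0)"

definition hol_disc :: "(complex \<Rightarrow> complex) set" where
  "hol_disc = {f. f holomorphic_on disc \<and> (\<forall>z. z \<notin> disc \<longrightarrow> f z = 0)}"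

text \<open>
  The topology of uniform convergence on compact sets. The strict inequality gives open sets,
  because \<open>\<bar>g - f\<bar>\<close> attains its maximum on \<open>K\<close>.
\<close>

definition hol_topology :: "(complex \<Rightarrow> complex) topology" where
  "hol_topology = topology_generated_by
     {{g \<in> hol_disc. \<forall>z\<in>K. norm (g z - f z) < e} | f K e.
        f \<in> hol_disc \<and> compact K \<and> K \<subseteq> disc \<and> 0 < e}"

definition disc_polys :: "(complex \<Rightarrow> complex) set" where
  "disc_polys = range (\<lambda>p :: complex poly. on_disc (poly p))"

definition odd_on_disc :: "(complex \<Rightarrow> complex) \<Rightarrow> bool" where
  "odd_on_disc f \<longleftrightarrow> (\<forall>z\<in>disc. f (- z) = - f z)"

text \<open>
  For \<open>0 < r < 1\<close> the argument \<open>r z\<close> lies in the disc for some \<open>z\<close> outside it, hence the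
  restriction.
\<close>

definition radial_dilate :: "real \<Rightarrow> (complex \<Rightarrow> complex) \<Rightarrow> complex \<Rightarrow> complex" where
  "radial_dilate r f = on_disc (\<lambda>z. f (of_real r * z))"

lemma topspace_hol_topology: "topspace hol_topology = hol_disc"
  unfolding hol_topology_def topology_generated_by_topspace
proof (intro equalityI subsetI)
  fix f assume "f \<in> hol_disc"
  then show "f \<in> \<Union> {{g \<in> hol_disc. \<forall>z\<in>K. norm (g z - f z) < e} | f K e.
        f \<in> hol_disc \<and> compact K \<and> K \<subseteq> disc \<and> 0 < (e::real)}"
    by (intro UnionI[of "{g \<in> hol_disc. \<forall>z\<in>{}. norm (g z - f z) < 1}"] CollectI exI[of _ f]
        exI[of _ "{}"] exI[of _ 1]) auto
qed auto


section \<open>Hilbert holomorphic function spaces\<close>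

definition cscale :: "complex \<Rightarrow> (complex \<Rightarrow> complex) \<Rightarrow> complex \<Rightarrow> complex" where
  "cscale c f = (\<lambda>z. c * f z)"

interpretation cfun: vector_space cscale
  by unfold_locales (auto simp: cscale_def fun_eq_iff algebra_simps)

definition ip_norm :: "((complex \<Rightarrow> complex) \<Rightarrow> (complex \<Rightarrow> complex) \<Rightarrow> complex)
    \<Rightarrow> (complex \<Rightarrow> complex) \<Rightarrow> real" where
  "ip_norm ip f = sqrt (Re (ip f f))"

text \<open>
  Nothing is assumed about \<open>ip\<close> outside \<open>H\<close>, whereas \<^locale>\<open>Metric_space\<close> requires symmetry and
  nonnegativity everywhere; hence the case distinction.
\<close>

definition ip_dist :: "(complex \<Rightarrow> complex) set
    \<Rightarrow> ((complex \<Rightarrow> complex) \<Rightarrow> (complex \<Rightarrow> complex) \<Rightarrow> complex)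
    \<Rightarrow> (complex \<Rightarrow> complex) \<Rightarrow> (complex \<Rightarrow> complex) \<Rightarrow> real" where
  "ip_dist H ip f g = (if f \<in> H \<and> g \<in> H then ip_norm ip (f - g) else 0)"

abbreviation ip_topology where
  "ip_topology H ip \<equiv> Metric_space.mtopology H (ip_dist H ip)"

locale complex_ip_function_space =
  fixes H :: "(complex \<Rightarrow> complex) set"
    and ip :: "(complex \<Rightarrow> complex) \<Rightarrow> (complex \<Rightarrow> complex) \<Rightarrow> complex"
  assumes subspace: "cfun.subspace H"
    and ip_add_left: "\<lbrakk>f \<in> H; g \<in> H; h \<in> H\<rbrakk> \<Longrightarrow> ip (f + g) h = ip f h + ip g h"
    and ip_cscale_left: "\<lbrakk>f \<in> H; g \<in> H\<rbrakk> \<Longrightarrow> ip (cscale c f) g = c * ip f g"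
    and ip_commute: "\<lbrakk>f \<in> H; g \<in> H\<rbrakk> \<Longrightarrow> ip f g = cnj (ip g f)"
    and ip_pos: "\<lbrakk>f \<in> H; f \<noteq> 0\<rbrakk> \<Longrightarrow> 0 < Re (ip f f)"
begin

lemma ip_zero_left: "f \<in> H \<Longrightarrow> ip 0 f = 0"
  using ip_cscale_left[of f f 0] by (simp add: cscale_def zero_fun_def)

lemma ip_nonneg: "f \<in> H \<Longrightarrow> 0 \<le> Re (ip f f)"
  using ip_pos[of f] ip_zero_left[of f] by (cases "f = 0") auto

lemma ip_real: "f \<in> H \<Longrightarrow> ip f f = of_real (Re (ip f f))"
  using ip_commute[of f f] by (simp add: complex_eq_iff)

lemma ip_add_right: "\<lbrakk>f \<in> H; g \<in> H; h \<in> H\<rbrakk> \<Longrightarrow> ip h (f + g) = ip h f + ip h g"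
  using ip_commute[of h] ip_add_left[of f g h] cfun.subspace_add[OF subspace]
  by (metis complex_cnj_add)

lemma ip_cscale_right: "\<lbrakk>f \<in> H; g \<in> H\<rbrakk> \<Longrightarrow> ip g (cscale c f) = cnj c * ip g f"
  using ip_commute[of g] ip_cscale_left[of f g c] cfun.subspace_scale[OF subspace]
  by (metis complex_cnj_mult)

lemma ip_expand:
  assumes "f \<in> H" "g \<in> H"
  shows "Re (ip (f + cscale c g) (f + cscale c g)) =
    Re (ip f f) + 2 * Re (c * ip g f) + (cmod c)\<^sup>2 * Re (ip g g)"
proof -
  have cg: "cscale c g \<in> H" using assms subspace by (simp add: cfun.subspace_scale)
  have fcg: "f + cscale c g \<in> H" using assms cg subspace by (simp add: cfun.subspace_add)
  have "ip (f + cscale c g) (f + cscale c g) =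
      ip f f + c * ip g f + (cnj c * ip f g + cnj c * c * ip g g)"
    using assms cg fcg
    by (simp add: ip_add_left ip_add_right ip_cscale_left ip_cscale_right algebra_simps)
  moreover have "cnj c * ip f g = cnj (c * ip g f)"
    using ip_commute[of f g] assms by simp
  moreover have "cnj c * c * ip g g = of_real ((cmod c)\<^sup>2 * Re (ip g g))"
    using ip_real[of g] assms(2)
    by (metis complex_norm_square mult.commute of_real_mult of_real_power)
  ultimately show ?thesis by simp
qed

lemma cauchy_schwarz:
  assumes "f \<in> H" "g \<in> H"
  shows "cmod (ip f g) \<le> ip_norm ip f * ip_norm ip g"
proof (cases "g = 0")
  case True
  then have "ip f g = 0"
    using assms ip_commute[of f g] ip_zero_left[of f] by simp
  then show ?thesis using assms by (simp add: ip_norm_def ip_nonneg)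
next
  case False
  define G where "G = Re (ip g g)"
  have G: "G > 0" using False assms ip_pos by (simp add: G_def)
  define c where "c = - (ip f g / of_real G)"
  have fcg: "f + cscale c g \<in> H"
    using assms subspace by (simp add: cfun.subspace_scale cfun.subspace_add)
  have "c * ip g f = - of_real ((cmod (ip f g))\<^sup>2 / G)"
    using ip_commute[of g f] assms G
    by (simp add: c_def complex_norm_square[symmetric] del: of_real_power)
  then have 1: "Re (c * ip g f) = - ((cmod (ip f g))\<^sup>2 / G)" by simp
  have 2: "(cmod c)\<^sup>2 * G = (cmod (ip f g))\<^sup>2 / G"
    using G by (simp add: c_def norm_divide power_divide power2_eq_square)
  have "0 \<le> Re (ip f f) - (cmod (ip f g))\<^sup>2 / G"
    using ip_nonneg[OF fcg] ip_expand[OF assms, of c] 1 2 by (simp add: G_def)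
  then have "(cmod (ip f g))\<^sup>2 \<le> Re (ip f f) * G"
    using G by (simp add: field_simps)
  then show ?thesis
    unfolding ip_norm_def G_def by (metis real_le_rsqrt real_sqrt_mult)
qed

lemma ip_norm_triangle:
  assumes "f \<in> H" "g \<in> H"
  shows "ip_norm ip (f + g) \<le> ip_norm ip f + ip_norm ip g"
proof -
  have "cscale 1 g = g" by (simp add: cscale_def)
  then have "Re (ip (f + g) (f + g)) = Re (ip f f) + 2 * Re (ip g f) + Re (ip g g)"
    using ip_expand[OF assms, of 1] by simp
  also have "Re (ip g f) \<le> ip_norm ip g * ip_norm ip f"
    using cauchy_schwarz[OF assms(2,1)] complex_Re_le_cmod[of "ip g f"] by linarith
  also have "Re (ip f f) + 2 * (ip_norm ip g * ip_norm ip f) + Re (ip g g)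
      = (ip_norm ip f + ip_norm ip g)\<^sup>2"
    using assms by (simp add: ip_norm_def ip_nonneg power2_sum)
  finally have "Re (ip (f + g) (f + g)) \<le> (ip_norm ip f + ip_norm ip g)\<^sup>2" by simp
  moreover have "0 \<le> ip_norm ip f + ip_norm ip g"
    using assms by (simp add: ip_norm_def ip_nonneg)
  ultimately show ?thesis
    by (simp add: ip_norm_def real_le_lsqrt)
qed

lemma Metric_space_ip: "Metric_space H (ip_dist H ip)"
proof
  fix f g
  have diff: "f - g \<in> H" if "f \<in> H" "g \<in> H" for f g
    using that subspace by (rule_tac cfun.subspace_diff)
  show "0 \<le> ip_dist H ip f g"
    by (simp add: ip_dist_def ip_norm_def ip_nonneg diff)
  show "ip_dist H ip f g = ip_dist H ip g f"
  proof (cases "f \<in> H \<and> g \<in> H")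
    case True
    have "g - f = cscale (-1) (f - g)" by (auto simp: cscale_def fun_eq_iff)
    moreover have "ip (cscale (-1) (f - g)) (cscale (-1) (f - g)) = ip (f - g) (f - g)"
      using True diff[of f g] cfun.subspace_scale[OF subspace, of "f - g" "-1"]
      by (simp only: ip_cscale_left ip_cscale_right) simp
    ultimately have "ip (g - f) (g - f) = ip (f - g) (f - g)" by metis
    then show ?thesis using True by (simp add: ip_dist_def ip_norm_def)
  qed (auto simp: ip_dist_def)
  show "ip_dist H ip f g = 0 \<longleftrightarrow> f = g" if "f \<in> H" "g \<in> H"
  proof
    assume "ip_dist H ip f g = 0"
    then have "Re (ip (f - g) (f - g)) = 0"
      using that by (simp add: ip_dist_def ip_norm_def)
    then have "f - g = 0"
      using ip_pos[of "f - g"] diff[OF that] by force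
    then show "f = g" by simp
  next
    assume "f = g"
    then show "ip_dist H ip f g = 0"
      using ip_zero_left[of 0] cfun.subspace_0[OF subspace] by (simp add: ip_dist_def ip_norm_def)
  qed
  fix h
  show "ip_dist H ip f h \<le> ip_dist H ip f g + ip_dist H ip g h"
    if "f \<in> H" "g \<in> H" "h \<in> H"
    using ip_norm_triangle[OF diff diff, of f g g h] that by (simp add: ip_dist_def)
qed

end

locale hilbert_hol_space = complex_ip_function_space +
  assumes subset_hol_disc: "H \<subseteq> hol_disc"
    and complete: "Metric_space.mcomplete H (ip_dist H ip)"
    and continuous_inclusion: "continuous_map (ip_topology H ip) hol_topology (\<lambda>f. f)"

end

theory Submission
  imports Defs
begin

text \<open>
  An odd function \<open>h \<in> H\<close> outside the closure of the odd polynomials is the required function.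
  The Taylor series of \<open>h\<close> has only odd terms, and since its coefficients and the norms of the
  monomials grow subexponentially, the series of each dilate \<open>h\<^sub>r\<close> converges
  absolutely in \<open>H\<close>. Hence all dilates of \<open>h\<close>, and so their closed linear span, lie in the closure
  of the odd polynomials.
\<close>

section \<open>Norm estimates and closures of subspaces in an inner product space of
  functions\<close>

context complex_ip_function_space
begin

lemma ip_norm_cscale:
  assumes "f \<in> H"
  shows "ip_norm ip (cscale c f) = cmod c * ip_norm ip f"
proof -
  have "cscale c f \<in> H" using assms subspace by (simp add: cfun.subspace_scale)
  then have "ip (cscale c f) (cscale c f) = (c * cnj c) * ip f f"
    using assms by (simp add: ip_cscale_left ip_cscale_right)
  also have "c * cnj c = of_real ((cmod c)\<^sup>2)" by (simp only: complex_norm_square)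
  finally have "Re (ip (cscale c f) (cscale c f)) = (cmod c)\<^sup>2 * Re (ip f f)"
    by simp
  then show ?thesis by (simp add: ip_norm_def real_sqrt_mult)
qed

lemma ip_norm_zero: "ip_norm ip 0 = 0"
  using ip_zero_left[of 0] cfun.subspace_0[OF subspace] by (simp add: ip_norm_def)

lemma ip_norm_sum:
  assumes "\<And>k. k \<in> A \<Longrightarrow> f k \<in> H"
  shows "ip_norm ip (sum f A) \<le> (\<Sum>k\<in>A. ip_norm ip (f k))"
  using assms
proof (induction A rule: infinite_finite_induct)
  case (insert k A)
  have "ip_norm ip (f k + sum f A) \<le> ip_norm ip (f k) + ip_norm ip (sum f A)"
    using insert.prems by (intro ip_norm_triangle cfun.subspace_sum[OF subspace]) auto
  also have "\<dots> \<le> ip_norm ip (f k) + (\<Sum>k\<in>A. ip_norm ip (f k))"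
    using insert by simp
  finally show ?case unfolding sum.insert[OF insert.hyps] .
qed (simp_all add: ip_norm_zero)

text \<open>Since \<open>ip_dist\<close> agrees with the norm of the difference on \<open>H\<close>,
  metric balls can be replaced by norm inequalities; the later closure arguments become plain
  epsilon estimates.\<close>

lemma closure_of_iff_ip_norm:
  assumes "S \<subseteq> H"
  shows "f \<in> ip_topology H ip closure_of S \<longleftrightarrow>
    f \<in> H \<and> (\<forall>e>0. \<exists>g\<in>S. ip_norm ip (g - f) < e)"
proof -
  interpret M: Metric_space H "ip_dist H ip" by (rule Metric_space_ip)
  have "(\<exists>g\<in>S. g \<in> M.mball f e) \<longleftrightarrow> (\<exists>g\<in>S. ip_norm ip (g - f) < e)" if "f \<in> H" for e
  proof (rule bex_cong[OF refl])
    fix g assume "g \<in> S"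
    then have "g \<in> H" using assms by blast
    moreover have "ip_dist H ip f g = ip_dist H ip g f" by (rule M.commute)
    ultimately show "g \<in> M.mball f e \<longleftrightarrow> ip_norm ip (g - f) < e"
      using that by (simp add: ip_dist_def)
  qed
  then show ?thesis
    unfolding M.metric_closure_of by (simp del: M.in_mball) blast
qed

text \<open>Addition and scaling are continuous in the norm, so approximants can be added and
  scaled. This is what lets the closure absorb a whole linear span once it contains the
  generators.\<close>

lemma subspace_closure_of:
  assumes "cfun.subspace S" "S \<subseteq> H"
  shows "cfun.subspace (ip_topology H ip closure_of S)"
proof (rule cfun.subspaceI)
  note * = closure_of_iff_ip_norm[OF assms(2)]
  show "0 \<in> ip_topology H ip closure_of S"
    using cfun.subspace_0[OF assms(1)] cfun.subspace_0[OF subspace]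
    by (auto simp: * ip_norm_zero intro!: bexI[of _ 0])
  fix f
  assume f: "f \<in> ip_topology H ip closure_of S"
  then have fH: "f \<in> H" by (simp add: *)
  show "f + g \<in> ip_topology H ip closure_of S" if g: "g \<in> ip_topology H ip closure_of S" for g
    unfolding *
  proof (intro conjI allI impI)
    have gH: "g \<in> H" using g by (simp add: *)
    show "f + g \<in> H" using fH gH subspace by (simp add: cfun.subspace_add)
    fix e :: real assume "e > 0"
    then obtain p q where pq: "p \<in> S" "q \<in> S"
      "ip_norm ip (p - f) < e / 2" "ip_norm ip (q - g) < e / 2"
      using f g by (metis * half_gt_zero)
    have "ip_norm ip ((p - f) + (q - g)) \<le> ip_norm ip (p - f) + ip_norm ip (q - g)"
      using pq assms(2) fH gH by (intro ip_norm_triangle cfun.subspace_diff[OF subspace]) auto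
    also have "(p - f) + (q - g) = (p + q) - (f + g)" by simp
    finally have "ip_norm ip ((p + q) - (f + g)) < e" using pq(3,4) by linarith
    then show "\<exists>h\<in>S. ip_norm ip (h - (f + g)) < e"
      using cfun.subspace_add[OF assms(1)] pq by blast
  qed
  show "cscale c f \<in> ip_topology H ip closure_of S" for c
    unfolding *
  proof (intro conjI allI impI)
    show "cscale c f \<in> H" using fH subspace by (simp add: cfun.subspace_scale)
    fix e :: real assume e: "e > 0"
    \<comment> \<open>Adding 1 keeps the divisor of \<open>e\<close> positive when
      \<open>c = 0\<close>.\<close>
    have pos: "0 < cmod c + 1" by (simp add: add_nonneg_pos)
    then obtain p where p: "p \<in> S" "ip_norm ip (p - f) < e / (cmod c + 1)"
      using f e by (metis * divide_pos_pos)
    have pf: "p - f \<in> H" using p assms(2) fH cfun.subspace_diff[OF subspace] by auto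
    have "ip_norm ip (cscale c (p - f)) \<le> (cmod c + 1) * ip_norm ip (p - f)"
      unfolding ip_norm_cscale[OF pf]
      using pf by (intro mult_right_mono) (simp_all add: ip_norm_def ip_nonneg)
    also have "\<dots> < e" using p pos by (simp add: field_simps)
    finally have "ip_norm ip (cscale c p - cscale c f) < e"
      by (simp add: cfun.scale_right_diff_distrib)
    then show "\<exists>h\<in>S. ip_norm ip (h - cscale c f) < e"
      using cfun.subspace_scale[OF assms(1)] p by blast
  qed
qed

end

section \<open>Convergence in \<open>H\<close> and pointwise convergence on the disc\<close>

lemma sum_function_apply: "(\<Sum>k\<in>A. f k) z = (\<Sum>k\<in>A. f k z)"
  by (induction A rule: infinite_finite_induct) auto

context hilbert_hol_space
begin

text \<open>Continuity of the inclusion carries the limit over to \<open>hol_topology\<close>. There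
  the singleton \<open>{z}\<close> is a compact set, so closeness at the one point \<open>z\<close>
  defines a basic open neighbourhood of \<open>g\<close>.\<close>

lemma limitin_pointwise:
  assumes "limitin (ip_topology H ip) F g sequentially" "z \<in> disc"
  shows "(\<lambda>n. F n z) \<longlonglongrightarrow> g z"
proof (rule tendstoI)
  fix e :: real assume "e > 0"
  have lim: "limitin hol_topology F g sequentially"
    using continuous_map_limit[OF continuous_inclusion assms(1)] by (simp add: o_def)
  then have g: "g \<in> hol_disc" by (simp add: limitin_def topspace_hol_topology)
  define U where "U = {h \<in> hol_disc. \<forall>w\<in>{z}. norm (h w - g w) < e}"
  have "openin hol_topology U"
    unfolding hol_topology_def U_def using g \<open>e > 0\<close> assms(2)
    by (intro topology_generated_by_Basis CollectI exI[of _ g] exI[of _ "{z}"] exI[of _ e]) auto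
  moreover have "g \<in> U" using g \<open>e > 0\<close> by (simp add: U_def)
  ultimately have "eventually (\<lambda>n. F n \<in> U) sequentially"
    using lim unfolding limitin_def by blast
  then show "eventually (\<lambda>n. dist (F n z) (g z) < e) sequentially"
    by eventually_elim (simp add: U_def dist_norm)
qed

text \<open>The partial sums are Cauchy by the triangle inequality, and completeness gives a limit.
  Its pointwise description serves to identify this abstract limit with a concrete function.\<close>

lemma absolutely_summable_limit:
  assumes "\<And>k. f k \<in> H" "summable (\<lambda>k. ip_norm ip (f k))"
  obtains g where "limitin (ip_topology H ip) (\<lambda>n. \<Sum>k<n. f k) g sequentially"
    "\<And>z. z \<in> disc \<Longrightarrow> (\<lambda>k. f k z) sums g z"
proof -
  interpret M: Metric_space H "ip_dist H ip" by (rule Metric_space_ip)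
  define S where "S = (\<lambda>n. \<Sum>k<n. f k)"
  have SH: "S n \<in> H" for n
    unfolding S_def using assms(1) by (intro cfun.subspace_sum[OF subspace])
  have le: "ip_dist H ip (S m) (S n) \<le> (\<Sum>k=m..<n. ip_norm ip (f k))" if "m \<le> n" for m n
  proof -
    have "S n - S m = (\<Sum>k=m..<n. f k)"
      unfolding S_def using that sum_diff_nat_ivl[of 0 m n f] by (simp add: lessThan_atLeast0)
    then show ?thesis
      using ip_norm_sum[of "{m..<n}" f] assms(1) SH
      by (subst M.commute) (simp add: ip_dist_def)
  qed
  have "M.MCauchy S"
    unfolding M.MCauchy_def
  proof (intro conjI allI impI)
    show "range S \<subseteq> H" using SH by auto
    fix e :: real assume "e > 0"
    then obtain N where N: "\<And>m n. m \<ge> N \<Longrightarrow> norm (\<Sum>k=m..<n. ip_norm ip (f k)) < e"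
      using assms(2) unfolding summable_Cauchy by blast
    have "ip_dist H ip (S m) (S n) < e" if "N \<le> m" "m \<le> n" for m n
      using le[OF that(2)] N[OF that(1), of n] by simp
    then show "\<exists>N. \<forall>m n. N \<le> m \<longrightarrow> N \<le> n \<longrightarrow> ip_dist H ip (S m) (S n) < e"
      by (metis M.commute nat_le_linear)
  qed
  then obtain g where g: "limitin M.mtopology S g sequentially"
    using complete unfolding M.mcomplete_def by blast
  have "(\<lambda>k. f k z) sums g z" if "z \<in> disc" for z
    using limitin_pointwise[OF g that] by (simp add: sums_def S_def sum_function_apply)
  then show ?thesis using that g unfolding S_def by blast
qed

end

section \<open>Odd polynomials, odd Taylor series and the root test\<close>

lemma subspace_odd_disc_polys: "cfun.subspace {f \<in> disc_polys. odd_on_disc f}"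
proof (rule cfun.subspaceI)
  have "0 = on_disc (poly 0)" by (auto simp: on_disc_def)
  then have "0 \<in> disc_polys" unfolding disc_polys_def by blast
  then show "0 \<in> {f \<in> disc_polys. odd_on_disc f}" by (simp add: odd_on_disc_def)
next
  fix f g
  assume fg: "f \<in> {f \<in> disc_polys. odd_on_disc f}" "g \<in> {f \<in> disc_polys. odd_on_disc f}"
  then obtain p q where "f = on_disc (poly p)" "g = on_disc (poly q)"
    by (auto simp: disc_polys_def)
  then have "f + g = on_disc (poly (p + q))" by (auto simp: on_disc_def)
  then have "f + g \<in> disc_polys" by (auto simp: disc_polys_def)
  then show "f + g \<in> {f \<in> disc_polys. odd_on_disc f}"
    using fg by (simp add: odd_on_disc_def)
next
  fix c f
  assume f: "f \<in> {f \<in> disc_polys. odd_on_disc f}"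
  then obtain p where "f = on_disc (poly p)" by (auto simp: disc_polys_def)
  then have "cscale c f = on_disc (poly (smult c p))" by (auto simp: on_disc_def cscale_def)
  then have "cscale c f \<in> disc_polys" by (auto simp: disc_polys_def)
  then show "cscale c f \<in> {f \<in> disc_polys. odd_on_disc f}"
    using f by (simp add: odd_on_disc_def cscale_def)
qed

lemma on_disc_power_in_disc_polys: "on_disc (\<lambda>z. z ^ n) \<in> disc_polys"
proof -
  have "(\<lambda>z::complex. z ^ n) = poly (monom 1 n)" by (rule ext) (simp add: poly_monom)
  then show ?thesis by (simp add: disc_polys_def)
qed

lemma odd_on_disc_power: "odd n \<Longrightarrow> odd_on_disc (on_disc (\<lambda>z. z ^ n))"
  by (simp add: odd_on_disc_def on_disc_def)

text \<open>Taking half the difference of the Taylor series at \<open>z\<close> and at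
  \<open>- z\<close> cancels the even terms and, by oddness, still sums to \<open>f z\<close>;
  uniqueness of the coefficients is not invoked.\<close>

lemma odd_power_series:
  assumes "f \<in> hol_disc" "odd_on_disc f"
  obtains b where "\<And>k. even k \<Longrightarrow> b k = 0" "\<And>z. z \<in> disc \<Longrightarrow> (\<lambda>k. b k * z ^ k) sums f z"
proof
  define a where "a = (\<lambda>k. (deriv ^^ k) f 0 / fact k)"
  define b where "b = (\<lambda>k. if even k then 0 else a k)"
  show "b k = 0" if "even k" for k using that by (simp add: b_def)
  fix z :: complex assume z: "z \<in> disc"
  have a: "(\<lambda>k. a k * w ^ k) sums f w" if "w \<in> disc" for w
    using holomorphic_power_series[of f 0 1 w] assms(1) that by (simp add: a_def hol_disc_def)
  have "(\<lambda>k. (a k * z ^ k - a k * (- z) ^ k) / 2) sums ((f z - f (- z)) / 2)"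
    using a[of z] a[of "- z"] z by (intro sums_divide sums_diff) auto
  moreover have "(a k * z ^ k - a k * (- z) ^ k) / 2 = b k * z ^ k" for k
    by (simp add: b_def)
  moreover have "(f z - f (- z)) / 2 = f z"
    using assms(2) z by (simp add: odd_on_disc_def)
  ultimately show "(\<lambda>k. b k * z ^ k) sums f z" by simp
qed

text \<open>The n-th root of the n-th term tends to \<open>s\<close>, which is below 1, so the root
  test applies.\<close>

lemma summable_power_times_subexponential:
  fixes \<omega> :: "nat \<Rightarrow> real"
  assumes "\<And>n. 0 < \<omega> n" "(\<lambda>n. root n (\<omega> n)) \<longlonglongrightarrow> 1" "0 \<le> s" "s < 1"
  shows "summable (\<lambda>n. s ^ n * \<omega> n)"
proof (rule root_test_convergence)
  have "(\<lambda>n. s * root n (\<omega> n)) \<longlonglongrightarrow> s * 1"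
    using assms(2) by (intro tendsto_mult) auto
  moreover have "eventually (\<lambda>n. s * root n (\<omega> n) = root n (norm (s ^ n * \<omega> n))) sequentially"
    \<comment> \<open>\<open>root 0\<close> is constantly 0, so cancelling
      \<open>root n (s ^ n)\<close> to \<open>s\<close> requires \<open>n > 0\<close>.\<close>
    using eventually_gt_at_top[of 0]
    by eventually_elim
      (use assms in \<open>simp add: real_root_mult real_root_power_cancel abs_mult less_imp_le\<close>)
  ultimately show "(\<lambda>n. root n (norm (s ^ n * \<omega> n))) \<longlonglongrightarrow> s"
    by (simp add: Lim_transform_eventually)
qed (fact assms)

section \<open>Dilates of odd functions as limits of odd polynomials\<close>

context hilbert_hol_space
begin

text \<open>The factor \<open>r ^ k\<close> in the Taylor terms of the dilate is split into two
  geometric factors: one keeps the coefficients of \<open>f\<close> bounded, the other outweighs the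
  growth of the monomial norms. The function \<open>f\<close> itself may lie outside
  \<open>H\<close>.\<close>

lemma odd_radial_dilate_in_closure:
  fixes \<omega> :: "nat \<Rightarrow> real"
  assumes \<omega>: "\<And>n. 0 < \<omega> n" "(\<lambda>n. root n (\<omega> n)) \<longlonglongrightarrow> 1"
    and polys: "disc_polys \<subseteq> H"
    and bound: "\<And>n. ip_norm ip (on_disc (\<lambda>z. z ^ n)) \<le> 1 + \<omega> n"
    and f: "f \<in> hol_disc" "odd_on_disc f"
    and r: "0 < r" "r < 1"
  shows "radial_dilate r f \<in> ip_topology H ip closure_of {f \<in> disc_polys. odd_on_disc f}"
proof -
  let ?P = "{f \<in> disc_polys. odd_on_disc f}"
  obtain b where b: "\<And>k. even k \<Longrightarrow> b k = 0" "\<And>z. z \<in> disc \<Longrightarrow> (\<lambda>k. b k * z ^ k) sums f z"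
    using odd_power_series[OF f] by blast
  \<comment> \<open>\<open>T k\<close> is the k-th Taylor term of the dilate, with value
    \<open>b k * (r * z) ^ k\<close> on the disc.\<close>
  define T where "T = (\<lambda>k. cscale (b k * of_real r ^ k) (on_disc (\<lambda>z. z ^ k)))"
  have TP: "T k \<in> ?P" for k
  proof (cases "even k")
    \<comment> \<open>An even monomial is not odd, but its coefficient vanishes, so
      \<open>T k\<close> is the zero function.\<close>
    case True
    then show ?thesis
      using cfun.subspace_0[OF subspace_odd_disc_polys] by (simp add: T_def b)
  next
    case False
    then show ?thesis
      unfolding T_def by (intro cfun.subspace_scale[OF subspace_odd_disc_polys])
        (simp add: on_disc_power_in_disc_polys odd_on_disc_power)
  qed
  then have TH: "T k \<in> H" for k using polys by blast
  \<comment> \<open>The square root splits \<open>r ^ k\<close> evenly into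
    \<open>s ^ k * s ^ k\<close> with \<open>s\<close> still below 1.\<close>
  define s where "s = sqrt r"
  have s: "0 < s" "s < 1" "s * s = r" using r by (simp_all add: s_def)
  \<comment> \<open>The point \<open>s\<close> lies in the disc, so the series converges there and
    its terms are bounded.\<close>
  have "summable (\<lambda>k. b k * of_real s ^ k)"
    using b(2)[of "of_real s"] s by (simp add: sums_iff)
  then obtain B where B: "\<And>k. cmod (b k * of_real s ^ k) \<le> B"
    using summable_imp_bounded[of "\<lambda>k. b k * of_real s ^ k"] by (auto simp: bounded_iff)
  have norm_T: "ip_norm ip (T k) \<le> B * (s ^ k + s ^ k * \<omega> k)" for k
  proof -
    have "ip_norm ip (T k) = cmod (b k * of_real r ^ k) * ip_norm ip (on_disc (\<lambda>z. z ^ k))"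
      unfolding T_def using polys on_disc_power_in_disc_polys by (intro ip_norm_cscale) blast
    also have "\<dots> \<le> cmod (b k * of_real r ^ k) * (1 + \<omega> k)"
      by (intro mult_left_mono bound) simp
    also have "cmod (b k * of_real r ^ k) = cmod (b k * of_real s ^ k) * s ^ k"
      using s by (simp add: norm_mult norm_power power_mult_distrib flip: s(3))
    also have "\<dots> * (1 + \<omega> k) \<le> B * s ^ k * (1 + \<omega> k)"
      using s \<omega>(1)[of k] by (intro mult_right_mono B) auto
    finally show ?thesis by (simp add: algebra_simps)
  qed
  have "summable (\<lambda>k. B * (s ^ k + s ^ k * \<omega> k))"
    using s by (intro summable_mult summable_add summable_geometric
        summable_power_times_subexponential \<omega>) auto
  then have "summable (\<lambda>k. ip_norm ip (T k))"
    by (rule summable_comparison_test'[where N = 0])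
      (use norm_T TH in \<open>simp add: ip_norm_def ip_nonneg\<close>)
  then obtain g where g: "limitin (ip_topology H ip) (\<lambda>n. \<Sum>k<n. T k) g sequentially"
    "\<And>z. z \<in> disc \<Longrightarrow> (\<lambda>k. T k z) sums g z"
    using absolutely_summable_limit[of T] TH by blast
  interpret M: Metric_space H "ip_dist H ip" by (rule Metric_space_ip)
  have gH: "g \<in> H" using g(1) by (rule M.limitin_mspace)
  \<comment> \<open>On the disc both sides are the sum of the same series; off the disc both vanish
    by the extension by zero.\<close>
  have "g = radial_dilate r f"
  proof (rule ext)
    fix z
    show "g z = radial_dilate r f z"
    proof (cases "z \<in> disc")
      case True
      then have "of_real r * z \<in> disc"
        using r mult_strict_mono[of r 1 "cmod z" 1] by (simp add: norm_mult)
      from b(2)[OF this] have "(\<lambda>k. T k z) sums f (of_real r * z)"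
        using True by (simp add: T_def cscale_def on_disc_def power_mult_distrib mult.assoc)
      then show ?thesis
        using g(2)[OF True] True by (simp add: radial_dilate_def on_disc_def sums_unique2)
    next
      case False
      then show ?thesis
        using gH subset_hol_disc by (auto simp: radial_dilate_def on_disc_def hol_disc_def)
    qed
  qed
  \<comment> \<open>The partial sums are odd polynomials, and a closed set contains the limits of
    its sequences.\<close>
  moreover have "g \<in> ip_topology H ip closure_of ?P"
  proof (rule limitin_closedin[OF g(1) closedin_closure_of])
    have "?P \<subseteq> ip_topology H ip closure_of ?P"
      using polys by (intro closure_of_subset) auto
    moreover have "(\<Sum>k<n. T k) \<in> ?P" for n
      by (rule cfun.subspace_sum[OF subspace_odd_disc_polys TP])
    ultimately show "eventually (\<lambda>n. (\<Sum>k<n. T k) \<in> ip_topology H ip closure_of ?P) sequentially"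
      by (intro always_eventually allI) (rule subsetD)
  qed simp
  ultimately show ?thesis by simp
qed

end

theorem corollary1p4:
  fixes \<omega> :: "nat \<Rightarrow> real"
    and H :: "(complex \<Rightarrow> complex) set"
    and ip :: "(complex \<Rightarrow> complex) \<Rightarrow> (complex \<Rightarrow> complex) \<Rightarrow> complex"
  assumes "\<And>n. 0 < \<omega> n"
    and "summable (\<lambda>n. 1 / \<omega> n)"
    and "(\<lambda>n. root n (\<omega> n)) \<longlonglongrightarrow> 1"
    and "hilbert_hol_space H ip"
    and "disc_polys \<subseteq> H"
    and "ip_topology H ip closure_of disc_polys = H"
    and "\<not> {f \<in> H. odd_on_disc f} \<subseteq> ip_topology H ip closure_of {f \<in> disc_polys. odd_on_disc f}"
    and "\<And>n. ip_norm ip (on_disc (\<lambda>z. z ^ n)) \<le> 1 + \<omega> n"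
  shows "\<exists>f\<in>H. f \<notin> ip_topology H ip closure_of
           cfun.span {radial_dilate r f | r. 0 < r \<and> r < 1}"
proof -
  interpret hilbert_hol_space H ip by (fact assms(4))
  let ?P = "{f \<in> disc_polys. odd_on_disc f}"
  obtain h where h: "h \<in> H" "odd_on_disc h" "h \<notin> ip_topology H ip closure_of ?P"
    using assms(7) by blast
  have "radial_dilate r h \<in> ip_topology H ip closure_of ?P" if "0 < r" "r < 1" for r
    using odd_radial_dilate_in_closure[OF assms(1,3,5,8) _ h(2) that] h(1) subset_hol_disc by blast
  \<comment> \<open>The closure of the odd polynomials is a subspace containing every dilate, hence
    their span; being closed, it also contains the closure of that span, whereas \<open>h\<close>
    lies outside it.\<close>
  then have "cfun.span {radial_dilate r h | r. 0 < r \<and> r < 1} \<subseteq> ip_topology H ip closure_of ?P"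
    using assms(5) by (intro cfun.span_minimal subspace_closure_of subspace_odd_disc_polys) auto
  then have "ip_topology H ip closure_of cfun.span {radial_dilate r h | r. 0 < r \<and> r < 1}
      \<subseteq> ip_topology H ip closure_of ?P"
    by (rule closure_of_minimal) simp
  then show ?thesis using h by blast
qed

end
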